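(* Let $(G(V_g,E_g),p(\cdot,\cdot))$ be a sampled graph whose bivariate distribution $p(\cdot,\cdot)$ has the same marginal distributions, i.e. $p_V(v)=p_W(v)$ for all $v\in V_g$, and consider the hierarchical agglomerative algorithm (Algorithm 1) described in the context, run on this sampled graph. (i) For the hierarchical agglomerative algorithm in Algorithm 1, the modularity index is non-decreasing in every iteration and thus converges to a local optimum. (ii) When the algorithm converges, every set returned by the hierarchical agglomerative algorithm is indeed a community. (iii) If, furthermore, we use the greedy selection that selects the two sets with the largest average correlation measure $\bar q(\cdot,\cdot)$ to merge in step (P4) of Algorithm 1, then the average correlation measure of the two selected sets in each merge operation is non-increasing.
   Context: A sampled graph $(G(V_g,E_g),p(\cdot,\cdot))$ consists of a finite (possibly directed) graph with vertex set $V_g=\{1,\dots,n\}$ and edge set $E_g$, together with a probability distribution $p$ on $V_g\times V_g$ (not necessarily symmetric), which is the joint law of a randomly selected ordered pair of nodes $(V,W)$: $\mathsf{P}(V=v,W=w)=p(v,w)$. Its marginals are $p_V(v)=\sum_{w}p(v,w)$ and $p_W(w)=\sum_{v}p(v,w)$. Assume $p_V=p_W$. For $S\subset V_g$, the centrality of $S$ is $C(S)=\mathsf{P}(V\in S)=\mathsf{P}(W\in S)$; for $S_1,S_2\subset V_g$, the relative centrality of $S_1$ with respect to $S_2$ is $C(S_1|S_2)=\mathsf{P}(W\in S_1\mid V\in S_2)$; the community strength of $S$ is $Str(S)=C(S|S)-C(S)$, and $S$ is called a community if $Str(S)\ge 0$. The modularity index of a partition $\mathcal{P}=\{S_c,\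 c=1,\dots,C\}$ of $V_g$ (where $C$ without argument is the number of sets) is $$Q(\mathcal{P})=\sum_{c=1}^{C} C(S_c)\cdot Str(S_c),$$ which can also be written as $Q(\mathcal{P})=\sum_{c=1}^{C}\sum_{v\in S_c}\sum_{w\in S_c}\bigl(p(v,w)-p_V(v)p_W(w)\bigr)$. In the algorithm below, the modularity index at an iteration is that of the partition formed by the current sets. Correlation measures: for nodes $v,w$, $$q(v,w)=\frac{p(v,w)-p_V(v)p_W(w)+p(w,v)-p_V(w)p_W(v)}{2};$$ for sets $S_1,S_2\subset V_g$, $q(S_1,S_2)=\sum_{v\in S_1}\sum_{w\in S_2}q(v,w)$; and the average correlation measure between two (nonempty) sets is $\bar q(S_1,S_2)=\dfrac{q(S_1,S_2)}{|S_1|\cdot|S_2|}$. Algorithm 1 (hierarchical agglomerative algorithm for community detection in a directed network): (P0) Input a sampled graph whose bivariate distribution has the same marginal distributions. (P1) Initially there are $n$ sets $S_i=\{i\}$, $i=1,\dots,n$. (P2) For all $i,j=1,\dots,n$, compute the correlation measures $q(S_i,S_j)=q(\{i\},\{j\})$. (P3) If there is only one set left, or there do not exist nonnegative correlation measures between two distinct sets, i.e. $q(S_i,S_j)<0$ for all $i\ne j$, then the algorithm outputs the current sets. (P4) Find two (distinct) sets that have a nonnegative correlation measure and merge them into a new set. If sets $i$ and $j$ are grouped into a new set $k$, then $S_k=S_i\cup S_j$; update $q(S_k,S_k)=q(S_i,S_i)+2q(S_i,S_j)+q(S_j,S_j)$ and, for all $\ell\ne k$, $q(S_k,S_\ell)=q(S_\ell,S_k)=q(S_i,S_\ell)+q(S_j,S_\ell)$.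 (P5) Repeat from (P3). *)

theory Defs
  imports "HOL-Probability.Probability"
begin

text \<open>
  The joint law of the ordered pair \<open>(V, W)\<close> is a probability mass function on pairs of nodes, so
  \<open>pmf p (v, w)\<close> is \<open>P(V = v, W = w)\<close>, and the random nodes \<open>V\<close>, \<open>W\<close> are \<open>fst\<close>, \<open>snd\<close>.
  Undirected graphs are those with a symmetric edge set.
\<close>

definition sampled_graph :: "nat \<Rightarrow> (nat \<times> nat) set \<Rightarrow> (nat \<times> nat) pmf \<Rightarrow> bool" where
  "sampled_graph n E p \<longleftrightarrow> E \<subseteq> {1..n} \<times> {1..n} \<and> set_pmf p \<subseteq> {1..n} \<times> {1..n}"

definition marginal_V :: "(nat \<times> nat) pmf \<Rightarrow> nat \<Rightarrow> real" where
  "marginal_V p v = pmf (map_pmf fst p) v"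

definition marginal_W :: "(nat \<times> nat) pmf \<Rightarrow> nat \<Rightarrow> real" where
  "marginal_W p w = pmf (map_pmf snd p) w"

definition centrality :: "(nat \<times> nat) pmf \<Rightarrow> nat set \<Rightarrow> real" where
  "centrality p S = \<P>(x in measure_pmf p. fst x \<in> S)"

text \<open>
  The conditional probability is \<open>0\<close> when the condition has probability \<open>0\<close>. A set of
  centrality \<open>0\<close> therefore has community strength \<open>0\<close> and contributes \<open>0\<close> to the modularity.
\<close>

definition relative_centrality :: "(nat \<times> nat) pmf \<Rightarrow> nat set \<Rightarrow> nat set \<Rightarrow> real" where
  "relative_centrality p S1 S2 = \<P>(x in measure_pmf p. snd x \<in> S1 \<bar> fst x \<in> S2)"

definition community_strength :: "(nat \<times> nat) pmf \<Rightarrow> nat set \<Rightarrow> real" where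
  "community_strength p S = relative_centrality p S S - centrality p S"

definition community :: "(nat \<times> nat) pmf \<Rightarrow> nat set \<Rightarrow> bool" where
  "community p S \<longleftrightarrow> 0 \<le> community_strength p S"

definition modularity :: "(nat \<times> nat) pmf \<Rightarrow> nat set set \<Rightarrow> real" where
  "modularity p P = (\<Sum>S\<in>P. centrality p S * community_strength p S)"

definition node_correlation :: "(nat \<times> nat) pmf \<Rightarrow> nat \<Rightarrow> nat \<Rightarrow> real" where
  "node_correlation p v w =
     (pmf p (v, w) - marginal_V p v * marginal_W p w
      + pmf p (w, v) - marginal_V p w * marginal_W p v) / 2"

definition correlation :: "(nat \<times> nat) pmf \<Rightarrow> nat set \<Rightarrow> nat set \<Rightarrow> real" where
  "correlation p S1 S2 = (\<Sum>v\<in>S1. \<Sum>w\<in>S2. node_correlation p v w)"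

definition avg_correlation :: "(nat \<times> nat) pmf \<Rightarrow> nat set \<Rightarrow> nat set \<Rightarrow> real" where
  "avg_correlation p S1 S2 = correlation p S1 S2 / (real (card S1) * real (card S2))"

text \<open>
  A state consists of the current sets and the stored table of correlation measures. Only the
  table entries of current sets are meaningful.
\<close>

record state =
  parts :: "nat set set"
  table :: "nat set \<Rightarrow> nat set \<Rightarrow> real"

definition initial_state :: "nat \<Rightarrow> (nat \<times> nat) pmf \<Rightarrow> state" where
  "initial_state n p =
     (let P = (\<lambda>i. {i}) ` {1..n}
      in \<lparr> parts = P,
           table = (\<lambda>S T. if S \<in> P \<and> T \<in> P then correlation p S T else 0) \<rparr>)"

definition halted :: "state \<Rightarrow> bool" where
  "halted s \<longleftrightarrow> card (parts s) = 1 \<or>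
     (\<forall>S\<in>parts s. \<forall>T\<in>parts s. S \<noteq> T \<longrightarrow> table s S T < 0)"

definition selectable :: "state \<Rightarrow> nat set \<Rightarrow> nat set \<Rightarrow> bool" where
  "selectable s A B \<longleftrightarrow> A \<in> parts s \<and> B \<in> parts s \<and> A \<noteq> B \<and> 0 \<le> table s A B"

definition merge :: "nat set \<Rightarrow> nat set \<Rightarrow> nat set set \<Rightarrow> nat set set" where
  "merge A B P = insert (A \<union> B) (P - {A, B})"

definition merge_table ::
    "nat set \<Rightarrow> nat set \<Rightarrow> (nat set \<Rightarrow> nat set \<Rightarrow> real) \<Rightarrow> nat set \<Rightarrow> nat set \<Rightarrow> real" where
  "merge_table A B q S T =
     (if S = A \<union> B \<and> T = A \<union> B then q A A + 2 * q A B + q B B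
      else if S = A \<union> B then q A T + q B T
      else if T = A \<union> B then q A S + q B S
      else q S T)"

definition merge_state :: "nat set \<Rightarrow> nat set \<Rightarrow> state \<Rightarrow> state" where
  "merge_state A B s =
     \<lparr> parts = merge A B (parts s), table = merge_table A B (table s) \<rparr>"

text \<open>
  An execution is an infinite sequence of states that stays constant once the algorithm has
  halted. The pair \<open>(A t, B t)\<close> is the pair merged at iteration \<open>t\<close>; it is unconstrained
  after halting. The choice among the selectable pairs is otherwise arbitrary.
\<close>

definition run ::
    "nat \<Rightarrow> (nat \<times> nat) pmf \<Rightarrow> (nat \<Rightarrow> nat set) \<Rightarrow> (nat \<Rightarrow> nat set) \<Rightarrow> (nat \<Rightarrow> state) \<Rightarrow> bool" where
  "run n p A B s \<longleftrightarrow> s 0 = initial_state n p \<and>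
     (\<forall>t. if halted (s t) then s (Suc t) = s t
          else selectable (s t) (A t) (B t) \<and> s (Suc t) = merge_state (A t) (B t) (s t))"

definition greedy_run ::
    "nat \<Rightarrow> (nat \<times> nat) pmf \<Rightarrow> (nat \<Rightarrow> nat set) \<Rightarrow> (nat \<Rightarrow> nat set) \<Rightarrow> (nat \<Rightarrow> state) \<Rightarrow> bool" where
  "greedy_run n p A B s \<longleftrightarrow> run n p A B s \<and>
     (\<forall>t. \<not> halted (s t) \<longrightarrow>
        (\<forall>S\<in>parts (s t). \<forall>T\<in>parts (s t). S \<noteq> T \<longrightarrow>
           avg_correlation p S T \<le> avg_correlation p (A t) (B t)))"

text \<open>
  Optimality is local with respect to the moves available to the algorithm: merging two distinct
  sets of the partition.
\<close>

definition local_optimum :: "(nat \<times> nat) pmf \<Rightarrow> nat set set \<Rightarrow> bool" where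
  "local_optimum p P \<longleftrightarrow>
     (\<forall>A\<in>P. \<forall>B\<in>P. A \<noteq> B \<longrightarrow> modularity p (merge A B P) \<le> modularity p P)"

end

theory Submission
  imports Defs
begin

text \<open>
  With equal marginals, the modularity of a partition is the sum of the self-correlations
  \<open>q(S, S)\<close>, so merging \<open>A\<close> and \<open>B\<close> changes it by \<open>2 q(A, B)\<close>; this gives monotonicity, and at a
  halted state (where all \<open>q(A, B)\<close> are negative) local optimality. Every row of the correlation
  matrix sums to zero, so \<open>q(S, S) = - \<Sum> q(S, T)\<close> over the other sets \<open>T\<close>, which is nonnegative
  at a halted state. Finally \<open>avg q(A \<union> B, T)\<close> is a weighted mean of \<open>avg q(A, T)\<close> and
  \<open>avg q(B, T)\<close>, so a greedy merge creates no pair with a larger average.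
\<close>

subsection \<open>Correlation measures\<close>

lemma node_correlation_commute: "node_correlation p v w = node_correlation p w v"
  by (simp add: node_correlation_def)

lemma correlation_commute: "correlation p S T = correlation p T S"
  unfolding correlation_def by (subst sum.swap) (simp add: node_correlation_commute)

lemma correlation_Un_left:
  assumes "finite A" "finite B" "A \<inter> B = {}"
  shows "correlation p (A \<union> B) T = correlation p A T + correlation p B T"
  using assms by (simp add: correlation_def sum.union_disjoint)

lemma correlation_Un_right:
  assumes "finite A" "finite B" "A \<inter> B = {}"
  shows "correlation p T (A \<union> B) = correlation p T A + correlation p T B"
  using correlation_Un_left[OF assms] by (metis correlation_commute)

lemma correlation_Un_Un:
  assumes "finite A" "finite B" "A \<inter> B = {}"
  shows "correlation p (A \<union> B) (A \<union> B) =
    correlation p A A + 2 * correlation p A B + correlation p B B"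
  using assms by (simp add: correlation_Un_left correlation_Un_right correlation_commute[of p B A])

lemma avg_correlation_commute: "avg_correlation p S T = avg_correlation p T S"
  by (simp add: avg_correlation_def correlation_commute[of p S T] mult.commute)

text \<open>Clearing denominators turns the bounds on averages into bounds on correlations, and both
  sides of these are additive over the disjoint union.\<close>

lemma avg_correlation_Un_le:
  assumes "finite A" "finite B" "A \<inter> B = {}" "A \<noteq> {}" "finite T" "T \<noteq> {}"
    and "avg_correlation p A T \<le> c" "avg_correlation p B T \<le> c"
  shows "avg_correlation p (A \<union> B) T \<le> c"
proof -
  have pos: "real (card A) > 0" "real (card T) > 0" "real (card B) \<ge> 0"
    using assms by (auto simp: card_gt_0_iff)
  have "correlation p A T \<le> c * (real (card A) * real (card T))"
    using assms(7) pos by (simp add: avg_correlation_def divide_le_eq)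
  \<comment> \<open>An empty \<open>B\<close> has average 0 / 0 = 0, which cannot be multiplied out;
    there both sides of this bound are simply 0.\<close>
  moreover have "correlation p B T \<le> c * (real (card B) * real (card T))"
  proof (cases "B = {}")
    case False
    then have "real (card B) > 0" using assms by (simp add: card_gt_0_iff)
    then show ?thesis using assms(8) pos by (simp add: avg_correlation_def divide_le_eq)
  qed (simp add: correlation_def)
  ultimately have "correlation p (A \<union> B) T \<le> c * (real (card (A \<union> B)) * real (card T))"
    using assms by (simp add: correlation_Un_left card_Un_disjoint algebra_simps)
  then show ?thesis
    using assms pos by (simp add: avg_correlation_def card_Un_disjoint divide_le_eq)
qed

section \<open>Centrality, marginals and self-correlation\<close>

lemma centrality_eq_sum:
  assumes "finite S"
  shows "centrality p S = (\<Sum>v\<in>S. marginal_V p v)"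
proof -
  have "centrality p S = measure (map_pmf fst p) S"
    by (simp add: centrality_def vimage_def)
  then show ?thesis
    using assms by (simp add: measure_measure_pmf_finite marginal_V_def del: measure_map_pmf)
qed

lemma marginal_V_eq_sum:
  assumes "set_pmf p \<subseteq> N \<times> N" "finite N"
  shows "marginal_V p v = (\<Sum>w\<in>N. pmf p (v, w))"
proof -
  \<comment> \<open>The fibre over \<open>v\<close> is infinite in the type of pairs; cutting it
    down to the support lets the finite set \<open>{v} \<times> N\<close> replace it.\<close>
  have "marginal_V p v = measure p (fst -` {v} \<inter> set_pmf p)"
    by (simp add: marginal_V_def pmf_map measure_Int_set_pmf)
  also have "fst -` {v} \<inter> set_pmf p = ({v} \<times> N) \<inter> set_pmf p"
    using assms by auto
  also have "measure p \<dots> = (\<Sum>x\<in>{v} \<times> N. pmf p x)"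
    using assms by (simp add: measure_Int_set_pmf measure_measure_pmf_finite)
  finally show ?thesis
    by (simp add: sum.cartesian_product')
qed

lemma marginal_W_eq_sum:
  assumes "set_pmf p \<subseteq> N \<times> N" "finite N"
  shows "marginal_W p w = (\<Sum>v\<in>N. pmf p (v, w))"
proof -
  have "marginal_W p w = measure p (snd -` {w} \<inter> set_pmf p)"
    by (simp add: marginal_W_def pmf_map measure_Int_set_pmf)
  also have "snd -` {w} \<inter> set_pmf p = (N \<times> {w}) \<inter> set_pmf p"
    using assms by auto
  also have "measure p \<dots> = (\<Sum>x\<in>N \<times> {w}. pmf p x)"
    using assms by (simp add: measure_Int_set_pmf measure_measure_pmf_finite)
  finally show ?thesis
    by (simp add: sum.cartesian_product')
qed

text \<open>Both marginals have total mass 1. Summed over \<open>w\<close>, the first two terms both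
  give \<open>marginal_V p v\<close>, the last two both give \<open>marginal_W p v\<close>, and each
  pair cancels.\<close>

lemma sum_node_correlation_eq_0:
  assumes "set_pmf p \<subseteq> N \<times> N" "finite N"
  shows "(\<Sum>w\<in>N. node_correlation p v w) = 0"
proof -
  have "set_pmf (map_pmf fst p) \<subseteq> N" "set_pmf (map_pmf snd p) \<subseteq> N"
    using assms by auto
  then have "(\<Sum>w\<in>N. marginal_V p w) = 1" "(\<Sum>w\<in>N. marginal_W p w) = 1"
    using assms by (simp_all add: marginal_V_def marginal_W_def sum_pmf_eq_1)
  then show ?thesis
    by (simp add: node_correlation_def sum_divide_distrib[symmetric] sum.distrib sum_subtractf
        sum_distrib_left[symmetric] sum_distrib_right[symmetric]
        marginal_V_eq_sum[OF assms, symmetric] marginal_W_eq_sum[OF assms, symmetric])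
qed

lemma correlation_partition_eq_0:
  assumes "set_pmf p \<subseteq> N \<times> N" "finite N" "partition_on N P"
  shows "(\<Sum>T\<in>P. correlation p S T) = 0"
proof -
  have "(\<Sum>T\<in>P. correlation p S T) = (\<Sum>v\<in>S. \<Sum>T\<in>P. \<Sum>w\<in>T. node_correlation p v w)"
    unfolding correlation_def by (rule sum.swap)
  also have "\<dots> = (\<Sum>v\<in>S. \<Sum>w\<in>N. node_correlation p v w)"
    using assms by (simp add: sum.partition)
  finally show ?thesis
    using assms by (simp add: sum_node_correlation_eq_0)
qed

text \<open>Multiplying by the centrality undoes the conditioning and leaves the joint probability
  of \<open>S \<times> S\<close>; equal marginals turn the squared centrality into the product term
  of the correlation.\<close>

lemma centrality_mult_strength:
  assumes "finite S" "marginal_V p = marginal_W p"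
  shows "centrality p S * community_strength p S = correlation p S S"
proof -
  let ?J = "\<P>(x in measure_pmf p. snd x \<in> S \<and> fst x \<in> S)"
  have "?J \<le> centrality p S"
    unfolding centrality_def by (intro measure_pmf.finite_measure_mono) auto
  \<comment> \<open>The product vanishes at centrality 0, so there the joint probability must vanish
    as well.\<close>
  then have zero: "?J = 0" if "centrality p S = 0"
    using that by (simp add: measure_le_0_iff)
  have *: "centrality p S * community_strength p S = ?J - centrality p S * centrality p S"
  proof (cases "centrality p S = 0")
    case False
    then show ?thesis
      by (simp add: community_strength_def relative_centrality_def cond_prob_def
          centrality_def right_diff_distrib)
  qed (use zero in simp)
  have "{x. snd x \<in> S \<and> fst x \<in> S} = S \<times> S"
    by auto
  then have J: "?J = (\<Sum>v\<in>S. \<Sum>w\<in>S. pmf p (v, w))"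
    using assms by (simp add: measure_measure_pmf_finite sum.cartesian_product)
  \<comment> \<open>On the square \<open>S \<times> S\<close> the transposed half of
    \<open>node_correlation\<close> has the same sum as the direct half, so symmetrising changes
    nothing.\<close>
  have J': "(\<Sum>v\<in>S. \<Sum>w\<in>S. pmf p (w, v)) = (\<Sum>v\<in>S. \<Sum>w\<in>S. pmf p (v, w))"
    by (rule sum.swap)
  have "correlation p S S = ?J - centrality p S * centrality p S"
    unfolding correlation_def node_correlation_def J centrality_eq_sum[OF assms(1)]
    by (simp add: assms(2)[symmetric] sum_divide_distrib[symmetric] sum.distrib sum_subtractf
        J' sum_distrib_left[symmetric] sum_distrib_right[symmetric])
  with * show ?thesis by simp
qed

lemma community_if_correlation_nonneg:
  assumes "finite S" "marginal_V p = marginal_W p" "0 \<le> correlation p S S"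
  shows "community p S"
proof (cases "centrality p S = 0")
  \<comment> \<open>The default value 0 of the conditional probability makes the strength 0, hence
    \<open>S\<close> a community.\<close>
  case True
  then show ?thesis
    by (simp add: community_def community_strength_def relative_centrality_def cond_prob_def
        centrality_def[symmetric])
next
  case False
  moreover have "centrality p S \<ge> 0"
    by (simp add: centrality_def)
  ultimately show ?thesis
    using assms(3) centrality_mult_strength[OF assms(1,2)]
    by (metis community_def less_eq_real_def zero_le_mult_iff not_less)
qed

subsection \<open>Merging two sets of a partition\<close>

lemma partition_on_part_props:
  assumes "partition_on N P" "finite N" "S \<in> P"
  shows "finite S" "S \<noteq> {}"
  using assms by (auto simp: partition_on_def intro: finite_subset)

lemma partition_on_disjoint:
  assumes "partition_on N P" "S \<in> P" "T \<in> P" "S \<noteq> T"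
  shows "S \<inter> T = {}"
  using assms by (auto simp: partition_on_def disjoint_def)

text \<open>A block containing the nonempty blocks \<open>A\<close> and \<open>B\<close> would meet
  both and so equal both. Hence \<open>insert\<close> in \<open>merge\<close> adds a genuinely new
  set, as counting and summing over the merged partition require.\<close>

lemma Un_notin_partition:
  assumes "partition_on N P" "A \<in> P" "B \<in> P" "A \<noteq> B"
  shows "A \<union> B \<notin> P"
proof
  assume "A \<union> B \<in> P"
  moreover have "A \<noteq> {}" "B \<noteq> {}"
    using assms by (auto simp: partition_on_def)
  ultimately show False
    using partition_on_disjoint[OF assms(1)] assms(2-4)
    by (metis Int_absorb1 Un_upper1 Un_upper2)
qed

lemma partition_on_merge:
  assumes "partition_on N P" "A \<in> P" "B \<in> P" "A \<noteq> B"
  shows "partition_on N (merge A B P)"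
proof (rule partition_onI)
  show "\<Union> (merge A B P) = N"
    using assms by (auto simp: partition_on_def merge_def)
next
  show "disjnt S T" if "S \<in> merge A B P" "T \<in> merge A B P" "S \<noteq> T" for S T
    using that assms partition_on_disjoint[OF assms(1)]
    by (auto simp: merge_def disjnt_def)
  show "{} \<notin> merge A B P"
    using assms by (auto simp: merge_def partition_on_def)
qed

lemma card_merge:
  assumes "partition_on N P" "finite N" "A \<in> P" "B \<in> P" "A \<noteq> B"
  shows "Suc (card (merge A B P)) = card P"
proof -
  have fin: "finite P"
    using assms by (auto intro: finite_elements)
  \<comment> \<open>The bound 2 keeps the natural-number subtraction in the cardinality of
    \<open>P - {A, B}\<close> from truncating.\<close>
  have "card {A, B} \<le> card P"
    using assms fin by (intro card_mono) auto
  then have "2 \<le> card P"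
    using assms by simp
  then show ?thesis
    using assms fin Un_notin_partition[OF assms(1,3,4,5)]
    by (simp add: merge_def card_Diff_subset)
qed

lemma modularity_merge:
  assumes "partition_on N P" "finite N" "marginal_V p = marginal_W p"
    and "A \<in> P" "B \<in> P" "A \<noteq> B"
  shows "modularity p (merge A B P) = modularity p P + 2 * correlation p A B"
proof -
  have mod: "modularity p Q = (\<Sum>S\<in>Q. correlation p S S)" if "partition_on N Q" for Q
    unfolding modularity_def
    using partition_on_part_props(1)[OF that assms(2)]
    by (intro sum.cong) (auto intro: centrality_mult_strength assms(3))
  have fin: "finite P" "finite A" "finite B"
    using assms finite_elements partition_on_part_props(1) by blast+
  have "(\<Sum>S\<in>P. correlation p S S) =
      correlation p A A + correlation p B B + (\<Sum>S\<in>P - {A, B}. correlation p S S)"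
    using assms fin by (subst sum.subset_diff[of "{A, B}"]) auto
  moreover have "(\<Sum>S\<in>merge A B P. correlation p S S) =
      correlation p (A \<union> B) (A \<union> B) + (\<Sum>S\<in>P - {A, B}. correlation p S S)"
    using fin Un_notin_partition[OF assms(1,4-6)] by (simp add: merge_def)
  ultimately show ?thesis
    using correlation_Un_Un[OF fin(2,3) partition_on_disjoint[OF assms(1,4-6)], of p]
    by (simp add: mod assms partition_on_merge)
qed

subsection \<open>Executions of the algorithm\<close>

text \<open>The algorithm reads only its stored table, so its tests must be tied to true
  correlations. The update rules mirror additivity of \<open>correlation\<close> in each
  argument.\<close>

lemma run_invariant:
  assumes "run n p A B s"
  shows "partition_on {1..n} (parts (s t)) \<and>
    (\<forall>S\<in>parts (s t). \<forall>T\<in>parts (s t). table (s t) S T = correlation p S T)"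
proof (induction t)
  case 0
  have "partition_on {1..n} ((\<lambda>i. {i}) ` {1..n})"
    by (rule partition_onI) (auto simp: disjnt_def)
  then show ?case
    using assms by (simp add: run_def initial_state_def Let_def)
next
  case (Suc t)
  show ?case
  proof (cases "halted (s t)")
    case True
    then show ?thesis using assms Suc by (simp add: run_def)
  next
    case False
    let ?P = "parts (s t)"
    from False have sel: "selectable (s t) (A t) (B t)"
      and st: "s (Suc t) = merge_state (A t) (B t) (s t)"
      using assms by (auto simp: run_def)
    from sel have AB: "A t \<in> ?P" "B t \<in> ?P" "A t \<noteq> B t"
      by (auto simp: selectable_def)
    from Suc have P: "partition_on {1..n} ?P" by simp
    have fin: "finite (A t)" "finite (B t)"
      using partition_on_part_props(1)[OF P] AB by auto
    note Un = fin partition_on_disjoint[OF P AB]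
    \<comment> \<open>Symmetry of \<open>correlation\<close> is needed when \<open>T\<close> is the
      new set: the stored value is then \<open>q A S + q B S\<close>, with the arguments
      swapped.\<close>
    have "table (s (Suc t)) S T = correlation p S T"
      if "S \<in> merge (A t) (B t) ?P" "T \<in> merge (A t) (B t) ?P" for S T
      using that Suc AB correlation_commute[of p]
      by (auto simp: st merge_state_def merge_table_def merge_def
          correlation_Un_Un[OF Un] correlation_Un_left[OF Un] correlation_Un_right[OF Un])
    then show ?thesis
      using partition_on_merge[OF P AB] by (simp add: st merge_state_def)
  qed
qed

lemma run_step:
  assumes "run n p A B s" "\<not> halted (s t)"
  shows "A t \<in> parts (s t)" "B t \<in> parts (s t)" "A t \<noteq> B t"
    and "0 \<le> correlation p (A t) (B t)"
    and "parts (s (Suc t)) = merge (A t) (B t) (parts (s t))"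
proof -
  have "selectable (s t) (A t) (B t) \<and> s (Suc t) = merge_state (A t) (B t) (s t)"
    using assms by (auto simp: run_def)
  then show "A t \<in> parts (s t)" "B t \<in> parts (s t)" "A t \<noteq> B t"
      "0 \<le> correlation p (A t) (B t)"
      "parts (s (Suc t)) = merge (A t) (B t) (parts (s t))"
    using run_invariant[OF assms(1), of t] by (auto simp: selectable_def merge_state_def)
qed

lemma run_halted_const:
  assumes "run n p A B s" "halted (s t)" "t \<le> u"
  shows "s u = s t"
  using assms(3)
proof (induction u rule: dec_induct)
  case (step u)
  then have "halted (s u)" using assms(2) by simp
  then show ?case using assms(1) step by (simp add: run_def)
qed simp

lemma run_halts:
  assumes "run n p A B s"
  shows "\<exists>T. halted (s T)"
proof (rule ccontr)
  assume "\<nexists>T. halted (s T)"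
  then have nh: "\<not> halted (s t)" for t by blast
  \<comment> \<open>Each merge lowers the number of sets by one, so this sum is conserved; a time
    exceeding the initial number of sets gives the contradiction.\<close>
  have "card (parts (s t)) + t = card (parts (s 0))" for t
  proof (induction t)
    case (Suc t)
    have "Suc (card (parts (s (Suc t)))) = card (parts (s t))"
      using run_step[OF assms nh, of t] run_invariant[OF assms, of t]
      by (simp add: card_merge[of "{1..n}"])
    with Suc show ?case by simp
  qed simp
  from this[of "Suc (card (parts (s 0)))"] show False by simp
qed

section \<open>Halted states and monotone modularity\<close>

lemma halted_correlation_neg:
  assumes "run n p A B s" "halted (s t)"
    and "S \<in> parts (s t)" "T \<in> parts (s t)" "S \<noteq> T"
  shows "correlation p S T < 0"
proof -
  \<comment> \<open>Two distinct sets exclude the one-set exit, leaving the negativity test.\<close>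
  have "card (parts (s t)) \<noteq> 1"
    using assms(3-5) by (auto simp: card_1_singleton_iff)
  then show ?thesis
    using assms run_invariant[OF assms(1), of t] by (metis halted_def)
qed

lemma run_modularity_incseq:
  assumes "run n p A B s" "marginal_V p = marginal_W p"
  shows "incseq (\<lambda>t. modularity p (parts (s t)))"
proof (rule incseq_SucI)
  fix t
  show "modularity p (parts (s t)) \<le> modularity p (parts (s (Suc t)))"
  proof (cases "halted (s t)")
    case True
    then show ?thesis using assms(1) by (simp add: run_def)
  next
    case False
    then show ?thesis
      using run_step[OF assms(1) False] run_invariant[OF assms(1), of t]
      by (simp add: modularity_merge[of "{1..n}"] assms(2))
  qed
qed

lemma halted_local_optimum:
  assumes "run n p A B s" "marginal_V p = marginal_W p" "halted (s t)"
  shows "local_optimum p (parts (s t))"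
  unfolding local_optimum_def
proof (intro ballI impI)
  fix S T assume ST: "S \<in> parts (s t)" "T \<in> parts (s t)" "S \<noteq> T"
  then show "modularity p (merge S T (parts (s t))) \<le> modularity p (parts (s t))"
    using halted_correlation_neg[OF assms(1,3) ST] run_invariant[OF assms(1), of t]
    by (simp add: modularity_merge[of "{1..n}"] assms(2))
qed

lemma halted_community:
  assumes "run n p A B s" "marginal_V p = marginal_W p" "set_pmf p \<subseteq> {1..n} \<times> {1..n}"
    and "halted (s t)" "S \<in> parts (s t)"
  shows "community p S"
proof -
  let ?P = "parts (s t)"
  have P: "partition_on {1..n} ?P"
    using run_invariant[OF assms(1)] by blast
  have "finite ?P"
    using P by (auto intro: finite_elements)
  then have "correlation p S S + (\<Sum>T\<in>?P - {S}. correlation p S T) = 0"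
    using correlation_partition_eq_0[OF assms(3) _ P, of S] assms(5)
    by (simp add: sum.remove)
  \<comment> \<open>If \<open>S\<close> is the only set, this sum is empty, so the one-set exit is
    covered too.\<close>
  moreover have "(\<Sum>T\<in>?P - {S}. correlation p S T) \<le> 0"
    using halted_correlation_neg[OF assms(1,4,5)] by (intro sum_nonpos) force
  ultimately show ?thesis
    using partition_on_part_props(1)[OF P _ assms(5)]
    by (intro community_if_correlation_nonneg assms(2)) auto
qed

section \<open>Greedy selection\<close>

lemma greedy_run_avg_correlation_Suc:
  assumes "greedy_run n p A B s" "\<not> halted (s t)" "\<not> halted (s (Suc t))"
  shows "avg_correlation p (A (Suc t)) (B (Suc t)) \<le> avg_correlation p (A t) (B t)"
proof -
  let ?P = "parts (s t)" and ?c = "avg_correlation p (A t) (B t)"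
  have run: "run n p A B s"
    and max: "\<And>S T. S \<in> ?P \<Longrightarrow> T \<in> ?P \<Longrightarrow> S \<noteq> T \<Longrightarrow> avg_correlation p S T \<le> ?c"
    using assms by (auto simp: greedy_run_def)
  have P: "partition_on {1..n} ?P"
    using run_invariant[OF run] by blast
  note AB = run_step[OF run assms(2)]
  note part = partition_on_part_props[OF P finite_atLeastAtMost]
  \<comment> \<open>Both \<open>(A t, T)\<close> and \<open>(B t, T)\<close> were candidates at
    iteration \<open>t\<close>, so greediness bounds the two averages that are being mixed.\<close>
  have new: "avg_correlation p (A t \<union> B t) T \<le> ?c" if "T \<in> ?P - {A t, B t}" for T
    using that AB(1-3) part max partition_on_disjoint[OF P AB(1-3)]
    by (intro avg_correlation_Un_le) auto
  have "avg_correlation p S T \<le> ?c"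
    if "S \<in> merge (A t) (B t) ?P" "T \<in> merge (A t) (B t) ?P" "S \<noteq> T" for S T
  proof -
    note ST = that
    consider "S = A t \<union> B t" "T \<in> ?P - {A t, B t}" | "T = A t \<union> B t" "S \<in> ?P - {A t, B t}"
      | "S \<in> ?P" "T \<in> ?P"
      using ST unfolding merge_def by blast
    then show ?thesis
      using new max ST(3) by cases (simp_all add: avg_correlation_commute[of p S "A t \<union> B t"])
  qed
  then show ?thesis
    using run_step[OF run assms(3)] AB(5) by simp
qed

lemma greedy_run_avg_correlation_antimono:
  assumes "greedy_run n p A B s" "t \<le> u" "\<not> halted (s u)"
  shows "avg_correlation p (A u) (B u) \<le> avg_correlation p (A t) (B t)"
  using assms(2,3)
proof (induction u rule: dec_induct)
  case (step u)
  have "run n p A B s"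
    using assms(1) by (simp add: greedy_run_def)
  \<comment> \<open>Halting persists, so a state not halted at \<open>Suc u\<close> was not halted
    at \<open>u\<close>.\<close>
  then have "\<not> halted (s u)"
    using step.prems run_halted_const[of n p A B s u "Suc u"] by auto
  then show ?case
    using step greedy_run_avg_correlation_Suc[OF assms(1)] by (meson order_trans)
qed simp

theorem theorem10:
  fixes n :: nat and E :: "(nat \<times> nat) set" and p :: "(nat \<times> nat) pmf"
  assumes "sampled_graph n E p"
    and "\<forall>v\<in>{1..n}. marginal_V p v = marginal_W p v"
  shows "(\<forall>A B s. run n p A B s \<longrightarrow>
            incseq (\<lambda>t. modularity p (parts (s t))) \<and>
            (\<exists>T. halted (s T) \<and> local_optimum p (parts (s T)) \<and>
               (\<lambda>t. modularity p (parts (s t))) \<longlonglongrightarrow> modularity p (parts (s T))))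
       \<and> (\<forall>A B s T. run n p A B s \<and> halted (s T) \<longrightarrow>
            (\<forall>S\<in>parts (s T). community p S))
       \<and> (\<forall>A B s t u. greedy_run n p A B s \<and> t \<le> u \<and> \<not> halted (s u) \<longrightarrow>
            avg_correlation p (A u) (B u) \<le> avg_correlation p (A t) (B t))"
proof -
  have supp: "set_pmf p \<subseteq> {1..n} \<times> {1..n}"
    using assms(1) by (simp add: sampled_graph_def)
  \<comment> \<open>Outside the vertex set both marginals are 0, which extends the assumed equality
    to all naturals.\<close>
  have marg: "marginal_V p = marginal_W p"
  proof
    fix v
    show "marginal_V p v = marginal_W p v"
    proof (cases "v \<in> {1..n}")
      case False
      then have "v \<notin> fst ` set_pmf p" "v \<notin> snd ` set_pmf p"
        using supp by auto
      then show ?thesis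
        by (simp add: marginal_V_def marginal_W_def pmf_eq_0_set_pmf[THEN iffD2])
    qed (use assms(2) in blast)
  qed
  have "\<exists>T. halted (s T) \<and> local_optimum p (parts (s T)) \<and>
      (\<lambda>t. modularity p (parts (s t))) \<longlonglongrightarrow> modularity p (parts (s T))"
    if run: "run n p A B s" for A B s
  proof -
    obtain T where T: "halted (s T)"
      using run_halts[OF run] by blast
    \<comment> \<open>The sequence is constant from \<open>T\<close> on.\<close>
    have "(\<lambda>t. modularity p (parts (s t))) \<longlonglongrightarrow> modularity p (parts (s T))"
      by (rule tendsto_eventually, unfold eventually_sequentially)
        (metis run_halted_const[OF run T])
    with T show ?thesis
      using halted_local_optimum[OF run marg T] by blast
  qed
  then show ?thesis
    using run_modularity_incseq[OF _ marg] halted_community[OF _ marg supp]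
      greedy_run_avg_correlation_antimono by blast
qed

end
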